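(* Let $\mathcal{C}\subseteq\mathbb{N}^p$ be an affine integer cone, $\preceq$ a total order on $\mathbb{N}^p$, and $f\in\mathcal{C}\setminus\{0\}$. Then $$\mathfrak{C}(Fb=f)/_\sim=\{[R]\mid R\in\mathfrak{B}(Fb=f)\}.$$ Moreover, if $R_1,R_2\in\mathfrak{B}(Fb=f)$ and $R_1\neq R_2$, then $[R_1]\cap[R_2]=\emptyset$.
   Context: $\mathbb{N}$ contains $0$. An affine integer cone $\mathcal{C}\subseteq\mathbb{N}^p$ is a set $L(A)\cap\mathbb{N}^p$ with $A\subseteq\mathcal{C}$ finite and non-empty, where $L(A)$ is the set of non-negative real linear combinations of elements of $A$. A $\mathcal{C}$-semigroup is a submonoid $S\subseteq\mathcal{C}$ (containing $0$) with $\mathcal{C}\setminus S$ finite. A total order on $\mathbb{N}^p$ means a total order relation compatible with addition and satisfying $0\preceq x$ for all $x$. For $S\ne\mathcal{C}$, $\mathrm{Fb}(S)=\max_\preceq(\mathcal{C}\setminus S)$, and $\mathfrak{C}(Fb=f)$ is the set of all $\mathcal{C}$-semigroups with Frobenius element $f$. Write $x\leq_{\mathcal{C}}y$ if $y-x\in\mathcal{C}$, $\mathcal{B}(f)=\{x\in\mathcal{C}\mid x\leq_{\mathcal{C}}f\}$, and $\mathcal{O}(S)=S\cup(\mathcal{C}\setminus\mathcal{B}(f))$. $\mathfrak{B}(Fb=f)$ is the set of $S\in\mathfrak{C}(Fb=f)$ with $\mathcal{O}(S)=S$. On $\mathfrak{C}(Fb=f)$ define the equivalence relation $S\sim T$ iff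 $\mathcal{O}(S)=\mathcal{O}(T)$ (equivalently $S\cap\mathcal{B}(f)=T\cap\mathcal{B}(f)$); $[S]=\{T\in\mathfrak{C}(Fb=f)\mid S\sim T\}$ is the class of $S$, and $\mathfrak{C}(Fb=f)/_\sim$ is the set of all classes. *)

theory Defs
  imports "HOL-Analysis.Finite_Cartesian_Product"
begin

definition real_vec :: "nat ^ 'p \<Rightarrow> real ^ 'p" where
  "real_vec x = (\<chi> i. real (x $ i))"

definition nonneg_span :: "(nat ^ 'p) set \<Rightarrow> (real ^ 'p) set" where
  "nonneg_span A =
     {\<Sum>a\<in>A. c a *\<^sub>R real_vec a | c :: nat ^ 'p \<Rightarrow> real. \<forall>a\<in>A. 0 \<le> c a}"

definition affine_integer_cone :: "(nat ^ 'p) set \<Rightarrow> bool" where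
  "affine_integer_cone C \<longleftrightarrow>
     (\<exists>A. A \<subseteq> C \<and> finite A \<and> A \<noteq> {} \<and> C = {x. real_vec x \<in> nonneg_span A})"

definition C_semigroup :: "(nat ^ 'p) set \<Rightarrow> (nat ^ 'p) set \<Rightarrow> bool" where
  "C_semigroup C S \<longleftrightarrow>
     S \<subseteq> C \<and> 0 \<in> S \<and> (\<forall>x\<in>S. \<forall>y\<in>S. x + y \<in> S) \<and> finite (C - S)"

text \<open>An order is given by its graph: \<open>(x, y) \<in> r\<close> stands for \<open>x \<preceq> y\<close>.\<close>

definition monoid_total_order :: "(nat ^ 'p) rel \<Rightarrow> bool" where
  "monoid_total_order r \<longleftrightarrow>
     linear_order r \<and>
     (\<forall>x y z. (x, y) \<in> r \<longrightarrow> (x + z, y + z) \<in> r) \<and>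
     (\<forall>x. (0, x) \<in> r)"

text \<open>The maximum of \<open>C - S\<close>. It exists and is unique when \<open>S\<close> is a \<open>C\<close>-semigroup
  different from \<open>C\<close>; for \<open>S = C\<close> the value is unspecified.\<close>

definition Fb :: "(nat ^ 'p) rel \<Rightarrow> (nat ^ 'p) set \<Rightarrow> (nat ^ 'p) set \<Rightarrow> nat ^ 'p" where
  "Fb r C S = (THE g. g \<in> C - S \<and> (\<forall>x\<in>C - S. (x, g) \<in> r))"

definition semigroups_Fb ::
    "(nat ^ 'p) rel \<Rightarrow> (nat ^ 'p) set \<Rightarrow> nat ^ 'p \<Rightarrow> (nat ^ 'p) set set" where
  "semigroups_Fb r C f = {S. C_semigroup C S \<and> S \<noteq> C \<and> Fb r C S = f}"

text \<open>The condition \<open>y - x \<in> C\<close> refers to the difference in \<open>\<int>\<^sup>p\<close>. It is written additively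
  because subtraction on \<open>nat\<close> truncates.\<close>

definition le_cone :: "(nat ^ 'p) set \<Rightarrow> nat ^ 'p \<Rightarrow> nat ^ 'p \<Rightarrow> bool" where
  "le_cone C x y \<longleftrightarrow> (\<exists>c\<in>C. y = x + c)"

definition below :: "(nat ^ 'p) set \<Rightarrow> nat ^ 'p \<Rightarrow> (nat ^ 'p) set" where
  "below C f = {x \<in> C. le_cone C x f}"

definition saturate ::
    "(nat ^ 'p) set \<Rightarrow> nat ^ 'p \<Rightarrow> (nat ^ 'p) set \<Rightarrow> (nat ^ 'p) set" where
  "saturate C f S = S \<union> (C - below C f)"

definition saturated_Fb ::
    "(nat ^ 'p) rel \<Rightarrow> (nat ^ 'p) set \<Rightarrow> nat ^ 'p \<Rightarrow> (nat ^ 'p) set set" where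
  "saturated_Fb r C f = {S \<in> semigroups_Fb r C f. saturate C f S = S}"

definition sim_Fb ::
    "(nat ^ 'p) rel \<Rightarrow> (nat ^ 'p) set \<Rightarrow> nat ^ 'p \<Rightarrow> (nat ^ 'p) set rel" where
  "sim_Fb r C f =
     {(S, T). S \<in> semigroups_Fb r C f \<and> T \<in> semigroups_Fb r C f \<and>
              saturate C f S = saturate C f T}"

lemma equiv_sim_Fb: "equiv (semigroups_Fb r C f) (sim_Fb r C f)"
  by (rule equivI) (auto simp: sim_Fb_def refl_on_def sym_def trans_def)

definition class_Fb ::
    "(nat ^ 'p) rel \<Rightarrow> (nat ^ 'p) set \<Rightarrow> nat ^ 'p \<Rightarrow> (nat ^ 'p) set \<Rightarrow> (nat ^ 'p) set set" where
  "class_Fb r C f S = sim_Fb r C f `` {S}"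

end

theory Submission
  imports Defs
begin

text \<open>Enlarging \<open>S\<close> by the complement of \<open>\<B>(f)\<close> keeps it a semigroup because \<open>\<B>(f)\<close> is
  closed under passing to summands, and keeps its Frobenius element because \<open>f \<in> \<B>(f)\<close>. Hence
  \<open>\<O>(S)\<close> is a saturated member of the class of \<open>S\<close>, and distinct saturated semigroups are
  inequivalent since each equals its own saturation.\<close>

lemma real_vec_add: "real_vec (x + y) = real_vec x + real_vec y"
  by (simp add: real_vec_def vec_eq_iff)

lemma zero_in_nonneg_span: "0 \<in> nonneg_span A"
  unfolding nonneg_span_def by (auto intro!: exI[of _ "\<lambda>_. 0"])

lemma nonneg_span_add:
  assumes "u \<in> nonneg_span A" and "v \<in> nonneg_span A"
  shows "u + v \<in> nonneg_span A"
proof -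
  obtain c where c: "u = (\<Sum>a\<in>A. c a *\<^sub>R real_vec a)" "\<forall>a\<in>A. 0 \<le> c a"
    using assms(1) unfolding nonneg_span_def by auto
  obtain d where d: "v = (\<Sum>a\<in>A. d a *\<^sub>R real_vec a)" "\<forall>a\<in>A. 0 \<le> d a"
    using assms(2) unfolding nonneg_span_def by auto
  have "u + v = (\<Sum>a\<in>A. (c a + d a) *\<^sub>R real_vec a)"
    by (simp add: c d sum.distrib scaleR_add_left)
  moreover have "\<forall>a\<in>A. 0 \<le> c a + d a"
    using c d by simp
  ultimately show ?thesis
    unfolding nonneg_span_def by (intro CollectI exI[of _ "\<lambda>a. c a + d a"] conjI)
qed

lemma affine_integer_cone_zero:
  fixes C :: "(nat ^ 'p) set"
  assumes "affine_integer_cone C"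
  shows "0 \<in> C"
proof -
  have "real_vec (0 :: nat ^ 'p) = 0"
    by (simp add: real_vec_def vec_eq_iff)
  then show ?thesis
    using assms unfolding affine_integer_cone_def by (auto simp: zero_in_nonneg_span)
qed

text \<open>Coefficients over the same generators add up. After this, the cone enters the argument
  only as a set that contains 0 and is closed under addition; the real span is not unfolded
  again.\<close>

lemma affine_integer_cone_add:
  assumes "affine_integer_cone C" and "x \<in> C" and "y \<in> C"
  shows "x + y \<in> C"
  using assms unfolding affine_integer_cone_def by (auto simp: real_vec_add nonneg_span_add)

lemma linear_order_finite_greatest:
  assumes "linear_order r" and "finite X" and "X \<noteq> {}"
  shows "\<exists>g\<in>X. \<forall>x\<in>X. (x, g) \<in> r"
  using assms(2,3)
proof (induction rule: finite_ne_induct)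
  case (singleton a)
  then show ?case
    using assms(1) by (auto simp: order_on_defs refl_on_def)
next
  case (insert a X)
  then obtain g where g: "g \<in> X" "\<forall>x\<in>X. (x, g) \<in> r"
    by auto
  have refl: "(a, a) \<in> r" and tot: "(a, g) \<in> r \<or> (g, a) \<in> r"
    using assms(1) by (auto simp: order_on_defs refl_on_def total_on_def) metis
  \<comment> \<open>If \<open>g\<close> lies below the new element \<open>a\<close>, transitivity
    makes \<open>a\<close> the greatest; otherwise totality leaves \<open>g\<close> in
    place.\<close>
  have "(x, a) \<in> r" if "x \<in> X" "(g, a) \<in> r" for x
    using assms(1) g that by (meson order_on_defs transD)
  then show ?case
    using g refl tot by blast
qed

text \<open>Finiteness and non-emptiness of the gap set give a greatest gap and antisymmetry makes
  it unique, so the definite description in \<open>Fb\<close> can be traded for its defining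
  property.\<close>

lemma Fb_eq_iff:
  assumes "linear_order r" and "finite (C - S)" and "C - S \<noteq> {}"
  shows "Fb r C S = f \<longleftrightarrow> f \<in> C - S \<and> (\<forall>x\<in>C - S. (x, f) \<in> r)"
proof -
  have anti: "antisym r"
    using assms(1) by (simp add: order_on_defs)
  have uniq: "Fb r C S = g" if "g \<in> C - S" "\<forall>x\<in>C - S. (x, g) \<in> r" for g
    unfolding Fb_def
  proof (rule the_equality)
    show "g \<in> C - S \<and> (\<forall>x\<in>C - S. (x, g) \<in> r)"
      using that by blast
    show "h = g" if "h \<in> C - S \<and> (\<forall>x\<in>C - S. (x, h) \<in> r)" for h
      using that \<open>g \<in> C - S\<close> \<open>\<forall>x\<in>C - S. (x, g) \<in> r\<close> anti by (meson antisymD)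
  qed
  then show ?thesis
    using linear_order_finite_greatest[OF assms] by metis
qed

text \<open>A gap \<open>f\<close> already forces \<open>S \<noteq> C\<close>, so membership becomes
  a condition free of \<open>THE\<close> that is easy to check for a saturation.\<close>

lemma mem_semigroups_Fb_iff:
  assumes "linear_order r"
  shows "S \<in> semigroups_Fb r C f \<longleftrightarrow>
    C_semigroup C S \<and> f \<in> C - S \<and> (\<forall>x\<in>C - S. (x, f) \<in> r)"
proof -
  have "C - S \<noteq> {} \<longleftrightarrow> S \<noteq> C" if "C_semigroup C S"
    using that by (auto simp: C_semigroup_def)
  then show ?thesis
    using Fb_eq_iff[OF assms, of C S f] by (auto simp: semigroups_Fb_def C_semigroup_def)
qed

text \<open>If \<open>x + y + c = f\<close>, then \<open>y + c\<close> lies in the cone and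
  witnesses that \<open>x\<close> is below \<open>f\<close>.\<close>

lemma below_summand:
  assumes "affine_integer_cone C" and "x \<in> C" and "y \<in> C" and "x + y \<in> below C f"
  shows "x \<in> below C f"
proof -
  obtain c where "c \<in> C" "f = (x + y) + c"
    using assms(4) by (auto simp: below_def le_cone_def)
  then have "y + c \<in> C" "f = x + (y + c)"
    using assms affine_integer_cone_add by (auto simp: add.assoc)
  then show ?thesis
    using assms(2) by (auto simp: below_def le_cone_def)
qed

lemma C_semigroup_saturate:
  assumes "affine_integer_cone C" and "C_semigroup C S"
  shows "C_semigroup C (saturate C f S)"
proof -
  have S: "S \<subseteq> C" "0 \<in> S" "\<And>x y. x \<in> S \<Longrightarrow> y \<in> S \<Longrightarrow> x + y \<in> S" "finite (C - S)"
    using assms(2) by (auto simp: C_semigroup_def)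
  \<comment> \<open>By contraposition of \<open>below_summand\<close>, the complement of
    \<open>below C f\<close> is an ideal of the monoid \<open>C\<close>.\<close>
  have absorb: "x + y \<in> C - below C f" if "x \<in> C - below C f" "y \<in> C" for x y
    using that below_summand[OF assms(1)] affine_integer_cone_add[OF assms(1)] by blast
  have "x + y \<in> saturate C f S" if "x \<in> saturate C f S" "y \<in> saturate C f S" for x y
  proof (cases "x \<in> S \<and> y \<in> S")
    case True
    then show ?thesis
      using S by (simp add: saturate_def)
  next
    case False
    \<comment> \<open>At least one summand lies in the ideal and the other in \<open>C\<close>; the
      two instances of \<open>absorb\<close> cover both positions.\<close>
    then have "x + y \<in> C - below C f"
      using that S(1) absorb[of x y] absorb[of y x]
      by (auto simp: saturate_def add.commute)
    then show ?thesis
      by (simp add: saturate_def)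
  qed
  moreover have "finite (C - saturate C f S)"
    by (rule finite_subset[OF _ S(4)]) (auto simp: saturate_def)
  ultimately show ?thesis
    using S unfolding C_semigroup_def by (auto simp: saturate_def)
qed

lemma saturate_idem: "saturate C f (saturate C f S) = saturate C f S"
  by (auto simp: saturate_def)

lemma saturate_mem_saturated_Fb:
  assumes "affine_integer_cone C" and "linear_order r" and "S \<in> semigroups_Fb r C f"
  shows "saturate C f S \<in> saturated_Fb r C f"
proof -
  have S: "C_semigroup C S" "f \<in> C - S" "\<forall>x\<in>C - S. (x, f) \<in> r"
    using assms(3) by (auto simp: mem_semigroups_Fb_iff[OF assms(2)])
  \<comment> \<open>Witness 0, from \<open>f = f + 0\<close>. So saturating does not add
    \<open>f\<close>; as it only removes gaps, \<open>f\<close> still bounds those that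
    remain.\<close>
  have "f \<in> below C f"
    using S(2) affine_integer_cone_zero[OF assms(1)]
    by (auto simp: below_def le_cone_def intro!: bexI[of _ 0])
  then have "f \<in> C - saturate C f S" "\<forall>x\<in>C - saturate C f S. (x, f) \<in> r"
    using S by (auto simp: saturate_def)
  then show ?thesis
    using C_semigroup_saturate[OF assms(1) S(1)]
    by (simp add: saturated_Fb_def saturate_idem mem_semigroups_Fb_iff[OF assms(2)])
qed

theorem proposition18:
  fixes C :: "(nat ^ 'p::finite) set"
    and r :: "(nat ^ 'p) rel"
    and f :: "nat ^ 'p"
  assumes "affine_integer_cone C"
    and "monoid_total_order r"
    and "f \<in> C - {0}"
  shows "semigroups_Fb r C f // sim_Fb r C f =
           {class_Fb r C f R | R. R \<in> saturated_Fb r C f} \<and>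
         (\<forall>R1\<in>saturated_Fb r C f. \<forall>R2\<in>saturated_Fb r C f.
            R1 \<noteq> R2 \<longrightarrow> class_Fb r C f R1 \<inter> class_Fb r C f R2 = {})"
proof (intro conjI ballI impI)
  have lin: "linear_order r"
    using assms(2) by (simp add: monoid_total_order_def)
  have sat: "saturate C f S \<in> saturated_Fb r C f" if "S \<in> semigroups_Fb r C f" for S
    by (rule saturate_mem_saturated_Fb[OF assms(1) lin that])
  \<comment> \<open>Idempotence of \<open>saturate\<close> makes \<open>S\<close> equivalent to its
    saturation, which thus serves as the saturated representative of the class.\<close>
  have cls: "class_Fb r C f (saturate C f S) = class_Fb r C f S"
    if "S \<in> semigroups_Fb r C f" for S
    using that sat[OF that]
    by (auto simp: class_Fb_def sim_Fb_def saturated_Fb_def saturate_idem)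
  have "semigroups_Fb r C f // sim_Fb r C f = class_Fb r C f ` semigroups_Fb r C f"
    by (auto simp: quotient_def class_Fb_def)
  also have "\<dots> = class_Fb r C f ` saturated_Fb r C f"
  proof (intro subset_antisym image_subsetI)
    fix S
    assume "S \<in> semigroups_Fb r C f"
    then show "class_Fb r C f S \<in> class_Fb r C f ` saturated_Fb r C f"
      using cls sat by (metis imageI)
  next
    fix R
    assume "R \<in> saturated_Fb r C f"
    then show "class_Fb r C f R \<in> class_Fb r C f ` semigroups_Fb r C f"
      by (simp add: saturated_Fb_def)
  qed
  finally show "semigroups_Fb r C f // sim_Fb r C f =
      {class_Fb r C f R | R. R \<in> saturated_Fb r C f}"
    by (simp add: image_def Bex_def conj_commute)
next
  fix R1 R2
  assume "R1 \<in> saturated_Fb r C f" "R2 \<in> saturated_Fb r C f" "R1 \<noteq> R2"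
  \<comment> \<open>A common member \<open>T\<close> would give
    \<open>R1 = saturate C f T = R2\<close>.\<close>
  then show "class_Fb r C f R1 \<inter> class_Fb r C f R2 = {}"
    by (auto simp: class_Fb_def sim_Fb_def saturated_Fb_def)
qed

end
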